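(* Let $\mathbb{Y}$ be a real $F$-space whose metric $d_{\mathbb{Y}}$ is homogeneous. Let $1<N\in\mathbb{N}$, let $\mathbb{X}$ be a nonempty connected set, and let $\{\mathbb{X}_i \mid i=1,\dots,N\}$ be a family of nonempty connected subsets of $\mathbb{X}$. Suppose $\{u_i:\mathbb{X}_i\to\mathbb{X}\mid i=1,\dots,N\}$ is a family of mappings, each a bijection onto its image $u_i(\mathbb{X}_i)$, such that $\mathbb{X}=\bigcup_{i=1}^N u_i(\mathbb{X}_i)$ and $u_i(\mathbb{X}_i)\cap u_j(\mathbb{X}_j)=\emptyset$ for all $i\ne j$. Fix $\boldsymbol{S}=(S_1,\dots,S_N)\in\prod_{i=1}^N B(\mathbb{X}_i,\mathbb{R})$ with $\max\{\|S_i\|_{\infty,\mathbb{X}_i}\mid i=1,\dots,N\}<1$. For $\boldsymbol{\lambda}=(\lambda_1,\dots,\lambda_N)\in\prod_{i=1}^N B(\mathbb{X}_i,\mathbb{Y})$ let $f^*(\boldsymbol{\lambda})\in B(\mathbb{X},\mathbb{Y})$ be the associated local fractal function, i.e. the unique element of $B(\mathbb{X},\mathbb{Y})$ satisfying $$f^*(\boldsymbol{\lambda})\circ u_i=\lambda_i+S_i\cdot f^*(\boldsymbol{\lambda})|_{\mathbb{X}_i}\quad\text{on }\mathbb{X}_i,\ i=1,\dots,N.$$ Then the mapping $\boldsymbol{\lambda}\mapsto f^*(\boldsymbol{\lambda})$ defines a linear isomorphism from $\prod_{i=1}^N B(\mathbb{X}_i,\mathbb{Y})$ to $B(\mathbb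{X},\mathbb{Y})$.
   Context: An $F$-space is a topological vector space whose topology is induced by a complete translation-invariant metric. The metric $d_{\mathbb{Y}}$ (complete, translation-invariant) is homogeneous if $d_{\mathbb{Y}}(\alpha y_1,\alpha y_2)=|\alpha|\,d_{\mathbb{Y}}(y_1,y_2)$ for all $\alpha\in\mathbb{R}$, $y_1,y_2\in\mathbb{Y}$. For a set $E$, a function $f:E\to\mathbb{Y}$ is bounded if there is $M>0$ with $d_{\mathbb{Y}}(f(x_1),f(x_2))<M$ for all $x_1,x_2\in E$; $B(E,\mathbb{Y})$ is the vector space (under pointwise operations) of bounded functions $E\to\mathbb{Y}$, with the complete metric $d(f,g):=\sup_{x\in E}d_{\mathbb{Y}}(f(x),g(x))$. $B(E,\mathbb{R})$ denotes the bounded real-valued functions on $E$, and $\|\cdot\|_{\infty,\mathbb{X}_i}$ is the supremum norm over $\mathbb{X}_i$. The local fractal function $f^*(\boldsymbol{\lambda})$ is the unique fixed point in $B(\mathbb{X},\mathbb{Y})$ of the operator $f\mapsto\sum_{i=1}^N(\lambda_i\circ u_i^{-1})\chi_{u_i(\mathbb{X}_i)}+\sum_{i=1}^N(S_i\circ u_i^{-1})\cdot(f|_{\mathbb{X}_i}\circ u_i^{-1})\chi_{u_i(\mathbb{X}_i)}$ (where $\chi_M$ is the indicator function of $M$), which is a contraction of $B(\mathbb{X},\mathbb{Y})$ under the assumption on $\boldsymbol{S}$. *)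

theory Defs
  imports "HOL-Analysis.Analysis" "HOL-Library.FuncSet" "Jordan_Normal_Form.VS_Connect"
begin

text \<open>
  A real F-space, given by its metric \<open>d\<close>; the vector space is the whole type. The topology is
  the one induced by \<open>d\<close>, and the last two assumptions say that it is a vector space topology.
\<close>

locale F_space = Metric_space "UNIV :: 'y::real_vector set" d
  for d :: "'y::real_vector \<Rightarrow> 'y \<Rightarrow> real" +
  assumes complete: "mcomplete"
    and translation_invariant: "d (x + z) (y + z) = d x y"
    and continuous_add:
      "continuous_map (prod_topology mtopology mtopology) mtopology (\<lambda>(x, y). x + y)"
    and continuous_scale:
      "continuous_map (prod_topology euclideanreal mtopology) mtopology (\<lambda>(c, x). c *\<^sub>R x)"

definition homogeneous_metric :: "('y::real_vector \<Rightarrow> 'y \<Rightarrow> real) \<Rightarrow> bool" where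
  "homogeneous_metric d \<longleftrightarrow> (\<forall>\<alpha> x y. d (\<alpha> *\<^sub>R x) (\<alpha> *\<^sub>R y) = \<bar>\<alpha>\<bar> * d x y)"

text \<open>
  Functions on \<open>E\<close> are represented by total functions that are \<open>undefined\<close> outside \<open>E\<close>, so that
  equality in \<open>bounded_funs d E\<close> is equality of functions on \<open>E\<close>.
\<close>

definition bounded_funs :: "('y \<Rightarrow> 'y \<Rightarrow> real) \<Rightarrow> 'x set \<Rightarrow> ('x \<Rightarrow> 'y) set" where
  "bounded_funs d E = {f \<in> E \<rightarrow>\<^sub>E UNIV. \<exists>M>0. \<forall>x\<in>E. \<forall>y\<in>E. d (f x) (f y) < M}"

text \<open>
  In the next two records, as for the modules \<open>module_vec\<close>, the ring multiplication and its unit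
  play no role.
\<close>

definition bounded_fun_space ::
    "('y::real_vector \<Rightarrow> 'y \<Rightarrow> real) \<Rightarrow> 'x set \<Rightarrow> (real, 'x \<Rightarrow> 'y) module" where
  "bounded_fun_space d E =
    \<lparr>carrier = bounded_funs d E, mult = undefined, one = undefined,
     zero = (\<lambda>x\<in>E. 0),
     add = (\<lambda>f g. \<lambda>x\<in>E. f x + g x),
     smult = (\<lambda>c f. \<lambda>x\<in>E. c *\<^sub>R f x)\<rparr>"

definition product_module :: "'i set \<Rightarrow> ('i \<Rightarrow> ('k, 'v) module) \<Rightarrow> ('k, 'i \<Rightarrow> 'v) module" where
  "product_module I V =
    \<lparr>carrier = (\<Pi>\<^sub>E i\<in>I. carrier (V i)), mult = undefined, one = undefined,
     zero = (\<lambda>i\<in>I. \<zero>\<^bsub>V i\<^esub>),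
     add = (\<lambda>f g. \<lambda>i\<in>I. f i \<oplus>\<^bsub>V i\<^esub> g i),
     smult = (\<lambda>c f. \<lambda>i\<in>I. c \<odot>\<^bsub>V i\<^esub> f i)\<rparr>"

text \<open>\<open>linear_map\<close> includes that both \<open>V\<close> and \<open>W\<close> are vector spaces over \<open>K\<close>.\<close>

definition linear_isomorphism ::
    "('k, 'c) ring_scheme \<Rightarrow> ('k, 'v, 'd) module_scheme \<Rightarrow> ('k, 'w, 'e) module_scheme \<Rightarrow>
      ('v \<Rightarrow> 'w) \<Rightarrow> bool" where
  "linear_isomorphism K V W T \<longleftrightarrow> linear_map K V W T \<and> bij_betw T (carrier V) (carrier W)"

definition sup_norm_on :: "'x set \<Rightarrow> ('x \<Rightarrow> real) \<Rightarrow> real" where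
  "sup_norm_on E g = (SUP x\<in>E. \<bar>g x\<bar>)"

text \<open>
  The operator is written with indicator functions; \<open>inv_into (Xs i) (u i)\<close> is the inverse of
  \<open>u i : Xs i \<rightarrow> u i ` Xs i\<close>, and its arbitrary values outside \<open>u i ` Xs i\<close> are cancelled by the
  indicator.
\<close>

definition fractal_operator ::
    "nat \<Rightarrow> 'x set \<Rightarrow> (nat \<Rightarrow> 'x set) \<Rightarrow> (nat \<Rightarrow> 'x \<Rightarrow> 'x) \<Rightarrow> (nat \<Rightarrow> 'x \<Rightarrow> real) \<Rightarrow>
      (nat \<Rightarrow> 'x \<Rightarrow> 'y::real_vector) \<Rightarrow> ('x \<Rightarrow> 'y) \<Rightarrow> 'x \<Rightarrow> 'y" where
  "fractal_operator N X Xs u S lam f = (\<lambda>x\<in>X.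
     (\<Sum>i=1..N. indicat_real (u i ` Xs i) x *\<^sub>R lam i (inv_into (Xs i) (u i) x)) +
     (\<Sum>i=1..N. indicat_real (u i ` Xs i) x *\<^sub>R
        (S i (inv_into (Xs i) (u i) x) *\<^sub>R f (inv_into (Xs i) (u i) x))))"

definition local_fractal_function ::
    "('y::real_vector \<Rightarrow> 'y \<Rightarrow> real) \<Rightarrow> nat \<Rightarrow> 'x set \<Rightarrow> (nat \<Rightarrow> 'x set) \<Rightarrow> (nat \<Rightarrow> 'x \<Rightarrow> 'x) \<Rightarrow>
      (nat \<Rightarrow> 'x \<Rightarrow> real) \<Rightarrow> (nat \<Rightarrow> 'x \<Rightarrow> 'y) \<Rightarrow> 'x \<Rightarrow> 'y" where
  "local_fractal_function d N X Xs u S lam =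
    (THE f. f \<in> bounded_funs d X \<and> fractal_operator N X Xs u S lam f = f)"

end

theory Submission
  imports Defs
begin

text \<open>
  The inverse of \<open>\<lambda> \<mapsto> f\<^sup>*(\<lambda>)\<close> can be written down without solving anything: the
  self-referential equation \<open>f \<circ> u\<^sub>i = \<lambda>\<^sub>i + S\<^sub>i \<cdot> f\<close> determines \<open>\<lambda>\<close> from \<open>f\<close> as
  \<open>\<lambda>\<^sub>i = f \<circ> u\<^sub>i - S\<^sub>i \<cdot> f\<close> on \<open>X\<^sub>i\<close>. This assignment (\<open>fractal_coefficients\<close>) is visibly linear, and
  it maps bounded functions to bounded functions because the \<open>S\<^sub>i\<close> are bounded. It is bijective
  exactly because every \<open>\<lambda>\<close> has one and only one bounded solution \<open>f\<close>, and the inverse of a linear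
  bijection is linear (\<open>linear_isomorphism_right_inverse\<close>).

  Existence and uniqueness are Banach's theorem. Since the sets \<open>u\<^sub>i(X\<^sub>i)\<close> partition \<open>X\<close>, each point
  of \<open>X\<close> is \<open>u\<^sub>i(x)\<close> for exactly one pair \<open>i\<close>, \<open>x \<in> X\<^sub>i\<close>, and at this point the fractal operator has
  the value \<open>\<lambda>\<^sub>i(x) + S\<^sub>i(x) f(x)\<close> (\<open>fractal_operator_at\<close>); hence its fixed points are the solutions
  of the self-referential equation. By translation invariance and homogeneity, the values for two
  functions \<open>f\<close> and \<open>g\<close> have distance \<open>\<bar>S\<^sub>i(x)\<bar>\<close> times the distance of \<open>f(x)\<close> and \<open>g(x)\<close>, so the
  operator contracts the uniform metric by the factor \<open>max \<parallel>S\<^sub>i\<parallel> < 1\<close>; and the bounded functions are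
  complete in this metric (\<open>bounded_funs_fixed_point\<close>).
\<close>

section \<open>Linear isomorphisms and products of vector spaces\<close>

text \<open>
  \<open>P\<close> is injective, so a right inverse is a two-sided one, and \<open>T\<close> inherits linearity by applying it
  to the equations \<open>P (T a + T b) = a + b\<close> and \<open>P (c T a) = c a\<close>.
\<close>

lemma linear_isomorphism_right_inverse:
  assumes iso: "linear_isomorphism K V W P"
    and closed: "\<And>w. w \<in> carrier W \<Longrightarrow> T w \<in> carrier V"
    and inverse: "\<And>w. w \<in> carrier W \<Longrightarrow> P (T w) = w"
  shows "linear_isomorphism K W V T"
proof -
  interpret P: linear_map K V W P
    using iso by (simp add: linear_isomorphism_def)
  have inj: "inj_on P (carrier V)"
    using iso by (simp add: linear_isomorphism_def bij_betw_def)
  have left_inverse: "T (P v) = v" if "v \<in> carrier V" for v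
    using that inverse[of "P v"] closed[of "P v"] inj by (auto dest: inj_onD)
  have "T \<in> module_hom K W V"
    unfolding module_hom_def
  proof (intro CollectI conjI allI impI)
    show "T \<in> carrier W \<rightarrow> carrier V"
      using closed by blast
    show "T (a \<oplus>\<^bsub>W\<^esub> b) = T a \<oplus>\<^bsub>V\<^esub> T b" if "a \<in> carrier W \<and> b \<in> carrier W" for a b
      using that left_inverse[of "T a \<oplus>\<^bsub>V\<^esub> T b"] by (simp add: closed inverse)
    show "T (c \<odot>\<^bsub>W\<^esub> a) = c \<odot>\<^bsub>V\<^esub> T a" if "c \<in> carrier K \<and> a \<in> carrier W" for c a
      using that left_inverse[of "c \<odot>\<^bsub>V\<^esub> T a"] by (simp add: closed inverse)
  qed
  then have "linear_map K W V T"
    using P.V.vectorspace_axioms P.W.vectorspace_axioms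
    by (auto simp: linear_map_def mod_hom_def mod_hom_axioms_def vectorspace_def)
  moreover have "bij_betw T (carrier W) (carrier V)"
    by (rule bij_betw_byWitness[where f' = P]) (auto simp: closed inverse left_inverse)
  ultimately show ?thesis
    by (simp add: linear_isomorphism_def)
qed

lemma vectorspace_product_module:
  assumes K: "field K" and V: "\<And>i. i \<in> I \<Longrightarrow> vectorspace K (V i)"
  shows "vectorspace K (product_module I V)"
proof -
  interpret K: field K
    by (rule K)
  have mod: "Module.module K (V i)" if "i \<in> I" for i
    using V[OF that] by (simp add: vectorspace_def)
  have grp: "abelian_group (V i)" if "i \<in> I" for i
    using mod[OF that] by (simp add: Module.module_def)
  note E = abelian_groupE[OF grp]
  have "abelian_group (product_module I V)"
  proof (rule abelian_groupI)
    fix f assume f: "f \<in> carrier (product_module I V)"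
    have "(\<lambda>i\<in>I. \<ominus>\<^bsub>V i\<^esub> f i) \<in> carrier (product_module I V)"
      using f by (auto simp: product_module_def intro!: abelian_group.a_inv_closed grp)
    moreover have "(\<lambda>i\<in>I. \<ominus>\<^bsub>V i\<^esub> f i) \<oplus>\<^bsub>product_module I V\<^esub> f = \<zero>\<^bsub>product_module I V\<^esub>"
      using f by (auto simp: product_module_def intro!: restrict_ext abelian_group.l_neg grp)
    ultimately show "\<exists>g \<in> carrier (product_module I V).
        g \<oplus>\<^bsub>product_module I V\<^esub> f = \<zero>\<^bsub>product_module I V\<^esub>"
      by blast
  qed (auto simp: product_module_def PiE_iff E(1-3,5) extensional_def intro!: ext E(4))
  then have "Module.module K (product_module I V)"
    by (rule moduleI[OF K.is_cring])
      (auto simp: product_module_def PiE_iff extensional_def intro!: ext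
        module.smult_closed[OF mod] module.smult_l_distr[OF mod] module.smult_r_distr[OF mod]
        module.smult_assoc1[OF mod] module.smult_one[OF mod])
  then show ?thesis
    by (simp add: vectorspace_def K)
qed

section \<open>Bounded functions with values in a homogeneous F-space\<close>

locale homogeneous_F_space = F_space d
  for d :: "'y::real_vector \<Rightarrow> 'y \<Rightarrow> real" +
  assumes homogeneous: "homogeneous_metric d"
begin

lemma d_scale: "d (c *\<^sub>R x) (c *\<^sub>R y) = \<bar>c\<bar> * d x y"
  using homogeneous by (simp add: homogeneous_metric_def)

lemma d_scale_zero: "d (c *\<^sub>R x) 0 = \<bar>c\<bar> * d x 0"
  using d_scale[of c x 0] by simp

lemma d_translate_left: "d (z + x) (z + y) = d x y"
  using translation_invariant[of x z y] by (simp add: add.commute)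

lemma d_add_zero_le: "d (x + y) 0 \<le> d x 0 + d y 0"
  using triangle[of "x + y" y 0] translation_invariant[of x y 0] by simp

lemma bounded_funs_eq_fspace:
  fixes E :: "'x set"
  shows "bounded_funs d E = fspace E"
proof -
  have "(\<exists>M>0. \<forall>x\<in>E. \<forall>y\<in>E. d (f x) (f y) < M) \<longleftrightarrow> mbounded (f ` E)" for f :: "'x \<Rightarrow> 'y"
  proof
    assume "mbounded (f ` E)"
    then obtain B where "B > 0" "\<forall>x\<in>E. \<forall>y\<in>E. d (f x) (f y) \<le> B"
      by (auto simp: mbounded_alt_pos)
    then show "\<exists>M>0. \<forall>x\<in>E. \<forall>y\<in>E. d (f x) (f y) < M"
      by (intro exI[of _ "B + 1"]) (force intro: le_less_trans[of _ B])
  qed (force simp: mbounded_alt intro: less_imp_le)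
  then show ?thesis
    by (auto simp: bounded_funs_def fspace_def PiE_iff)
qed

text \<open>
  Homogeneity makes \<open>d _ 0\<close> a norm, so boundedness may be tested against the single centre \<open>0\<close>;
  in this form it is stable under the linear operations.
\<close>

lemma bounded_funs_iff:
  "f \<in> bounded_funs d E \<longleftrightarrow> f \<in> extensional E \<and> (\<exists>B. \<forall>x\<in>E. d (f x) 0 \<le> B)"
proof
  assume "f \<in> bounded_funs d E"
  then have f: "f \<in> extensional E" "mbounded (f ` E)"
    by (auto simp: bounded_funs_eq_fspace fspace_def)
  then have "mbounded (insert 0 (f ` E))"
    by (simp add: mbounded_insert)
  with f show "f \<in> extensional E \<and> (\<exists>B. \<forall>x\<in>E. d (f x) 0 \<le> B)"
    by (auto simp: mbounded_alt)
next
  assume "f \<in> extensional E \<and> (\<exists>B. \<forall>x\<in>E. d (f x) 0 \<le> B)"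
  then obtain B where f: "f \<in> extensional E" and "\<forall>x\<in>E. d (f x) 0 \<le> B"
    by blast
  then have "f ` E \<subseteq> mcball 0 B"
    by (auto simp: commute)
  with f show "f \<in> bounded_funs d E"
    by (auto simp: bounded_funs_eq_fspace fspace_def mbounded_def)
qed

lemma bounded_funsI:
  assumes "f \<in> extensional E" and "\<And>x. x \<in> E \<Longrightarrow> d (f x) 0 \<le> B"
  shows "f \<in> bounded_funs d E"
  using assms by (auto simp: bounded_funs_iff)

lemma bounded_funsE:
  assumes "f \<in> bounded_funs d E"
  obtains B where "\<And>x. x \<in> E \<Longrightarrow> d (f x) 0 \<le> B"
  using assms by (auto simp: bounded_funs_iff)

lemma bounded_funs_extensional: "f \<in> bounded_funs d E \<Longrightarrow> f \<in> extensional E"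
  by (simp add: bounded_funs_iff)

lemma bounded_funs_add:
  assumes "f \<in> bounded_funs d E" and "g \<in> bounded_funs d E"
  shows "(\<lambda>x\<in>E. f x + g x) \<in> bounded_funs d E"
proof -
  obtain B where B: "\<And>x. x \<in> E \<Longrightarrow> d (f x) 0 \<le> B"
    using bounded_funsE[OF assms(1)] by blast
  obtain C where C: "\<And>x. x \<in> E \<Longrightarrow> d (g x) 0 \<le> C"
    using bounded_funsE[OF assms(2)] by blast
  have "d (f x + g x) 0 \<le> B + C" if "x \<in> E" for x
    using d_add_zero_le[of "f x" "g x"] B[OF that] C[OF that] by linarith
  then show ?thesis
    by (intro bounded_funsI[of _ _ "B + C"]) auto
qed

lemma bounded_funs_multiply:
  assumes f: "f \<in> bounded_funs d E" and s: "\<And>x. x \<in> E \<Longrightarrow> \<bar>a x\<bar> \<le> s"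
  shows "(\<lambda>x\<in>E. a x *\<^sub>R f x) \<in> bounded_funs d E"
proof -
  obtain B where B: "\<And>x. x \<in> E \<Longrightarrow> d (f x) 0 \<le> B"
    using bounded_funsE[OF f] by blast
  have "d (a x *\<^sub>R f x) 0 \<le> s * B" if "x \<in> E" for x
  proof -
    have "0 \<le> s"
      using s[OF that] by linarith
    then show ?thesis
      using mult_mono[OF s B] that by (simp add: d_scale_zero)
  qed
  then show ?thesis
    by (intro bounded_funsI[of _ _ "s * B"]) auto
qed

lemma bounded_funs_zero: "(\<lambda>x\<in>E. 0) \<in> bounded_funs d E"
  by (rule bounded_funsI[of _ _ 0]) auto

lemma vectorspace_bounded_fun_space:
  "vectorspace class_ring (bounded_fun_space d E)"
proof -
  have scale: "(\<lambda>x\<in>E. c *\<^sub>R f x) \<in> bounded_funs d E" if "f \<in> bounded_funs d E" for c f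
    by (rule bounded_funs_multiply[OF that order_refl])
  have "abelian_group (bounded_fun_space d E)"
  proof (rule abelian_groupI)
    fix f assume "f \<in> carrier (bounded_fun_space d E)"
    then show "\<exists>g\<in>carrier (bounded_fun_space d E).
        g \<oplus>\<^bsub>bounded_fun_space d E\<^esub> f = \<zero>\<^bsub>bounded_fun_space d E\<^esub>"
      using scale[of f "-1"]
      by (intro bexI[of _ "\<lambda>x\<in>E. (-1) *\<^sub>R f x"]) (auto simp: bounded_fun_space_def)
  next
    fix f g assume "f \<in> carrier (bounded_fun_space d E)" "g \<in> carrier (bounded_fun_space d E)"
    then show "f \<oplus>\<^bsub>bounded_fun_space d E\<^esub> g \<in> carrier (bounded_fun_space d E)"
      by (simp add: bounded_fun_space_def bounded_funs_add)
  qed (auto simp: bounded_fun_space_def bounded_funs_zero add.commute add.assoc extensional_def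
      intro!: ext dest!: bounded_funs_extensional)
  then have "Module.module class_ring (bounded_fun_space d E)"
    by (rule moduleI[OF class_cring.is_cring])
      (auto simp: bounded_fun_space_def scale algebra_simps extensional_def
        intro!: ext dest!: bounded_funs_extensional)
  then show ?thesis
    by (simp add: vectorspace_def class_field)
qed

text \<open>
  Banach's theorem for the uniform metric. The contraction hypothesis speaks of pointwise distances
  with an arbitrary uniform bound \<open>B\<close>, which spares applications all handling of suprema; taking
  for \<open>B\<close> the uniform distance of \<open>f\<close> and \<open>g\<close> gives back the Lipschitz condition.
\<close>

lemma bounded_funs_fixed_point:
  assumes E: "E \<noteq> {}" and s: "s < 1"
    and closed: "\<And>f. f \<in> bounded_funs d E \<Longrightarrow> F f \<in> bounded_funs d E"
    and contraction: "\<And>f g y B. \<lbrakk>f \<in> bounded_funs d E; g \<in> bounded_funs d E; y \<in> E;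
      \<And>x. x \<in> E \<Longrightarrow> d (f x) (g x) \<le> B\<rbrakk> \<Longrightarrow> d (F f y) (F g y) \<le> s * B"
  shows "\<exists>!f. f \<in> bounded_funs d E \<and> F f = f"
proof -
  interpret B: Metric_space "fspace E" "fdist E"
    by (rule Metric_space_funspace)
  have maps: "F \<in> fspace E \<rightarrow> fspace E"
    using closed by (auto simp: bounded_funs_eq_fspace)
  have Lipschitz: "fdist E (F f) (F g) \<le> s * fdist E f g" if "f \<in> fspace E" "g \<in> fspace E" for f g
  proof -
    have "d (f x) (g x) \<le> fdist E f g" if "x \<in> E" for x
      using funspace_mdist_le[OF \<open>f \<in> fspace E\<close> \<open>g \<in> fspace E\<close> E, of "fdist E f g"] that by simp
    then have "d (F f y) (F g y) \<le> s * fdist E f g" if "y \<in> E" for y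
      using contraction[of f g y "fdist E f g"] that \<open>f \<in> fspace E\<close> \<open>g \<in> fspace E\<close>
      by (simp add: bounded_funs_eq_fspace)
    moreover have "F f \<in> fspace E" "F g \<in> fspace E"
      using maps that by auto
    ultimately show ?thesis
      using funspace_mdist_le[OF _ _ E] by blast
  qed
  have "B.mcomplete"
    using mcomplete_funspace[OF complete, of E] by (simp add: mcomplete_of_def)
  moreover have "fspace E \<noteq> {}"
    using bounded_funs_zero by (auto simp: bounded_funs_eq_fspace)
  ultimately obtain f where "f \<in> fspace E" "F f = f"
    using B.Banach_fixedpoint_thm[OF _ _ maps s Lipschitz] by blast
  then show ?thesis
    using B.contraction_imp_unique_fixpoint[OF _ _ maps s Lipschitz]
    by (auto simp: bounded_funs_eq_fspace)
qed

end

section \<open>Local fractal functions\<close>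

text \<open>The map \<open>f \<mapsto> \<lambda>\<close> that turns out to be the inverse of \<open>\<lambda> \<mapsto> f\<^sup>*(\<lambda>)\<close>.\<close>

definition fractal_coefficients ::
    "nat \<Rightarrow> (nat \<Rightarrow> 'x set) \<Rightarrow> (nat \<Rightarrow> 'x \<Rightarrow> 'x) \<Rightarrow> (nat \<Rightarrow> 'x \<Rightarrow> real) \<Rightarrow>
      ('x \<Rightarrow> 'y::real_vector) \<Rightarrow> nat \<Rightarrow> 'x \<Rightarrow> 'y" where
  "fractal_coefficients N Xs u S f = (\<lambda>i\<in>{1..N}. \<lambda>x\<in>Xs i. f (u i x) - S i x *\<^sub>R f x)"

locale local_fractal_system = homogeneous_F_space d
  for d :: "'y::real_vector \<Rightarrow> 'y \<Rightarrow> real" +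
  fixes N :: nat and X :: "'x set" and Xs :: "nat \<Rightarrow> 'x set"
    and u :: "nat \<Rightarrow> 'x \<Rightarrow> 'x" and S :: "nat \<Rightarrow> 'x \<Rightarrow> real" and s :: real
  assumes X_nonempty: "X \<noteq> {}"
    and Xs_subset: "i \<in> {1..N} \<Longrightarrow> Xs i \<subseteq> X"
    and inj_u: "i \<in> {1..N} \<Longrightarrow> inj_on (u i) (Xs i)"
    and X_cover: "X = (\<Union>i\<in>{1..N}. u i ` Xs i)"
    and disjoint: "\<lbrakk>i \<in> {1..N}; j \<in> {1..N}; i \<noteq> j\<rbrakk> \<Longrightarrow> u i ` Xs i \<inter> u j ` Xs j = {}"
    and S_bound: "\<lbrakk>i \<in> {1..N}; x \<in> Xs i\<rbrakk> \<Longrightarrow> \<bar>S i x\<bar> \<le> s"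
    and s_less_1: "s < 1"
begin

abbreviation coefficient_families :: "(nat \<Rightarrow> 'x \<Rightarrow> 'y) set" where
  "coefficient_families \<equiv> (\<Pi>\<^sub>E i\<in>{1..N}. bounded_funs d (Xs i))"

lemma u_in_X: "\<lbrakk>i \<in> {1..N}; x \<in> Xs i\<rbrakk> \<Longrightarrow> u i x \<in> X"
  using X_cover by blast

text \<open>By disjointness, the \<open>i\<close>-th indicator is the only one that is nonzero at a point of \<open>u\<^sub>i(X\<^sub>i)\<close>.\<close>

lemma fractal_operator_at:
  fixes lam :: "nat \<Rightarrow> 'x \<Rightarrow> 'y"
  assumes i: "i \<in> {1..N}" and x: "x \<in> Xs i"
  shows "fractal_operator N X Xs u S lam f (u i x) = lam i x + S i x *\<^sub>R f x"
proof -
  have indicator: "indicat_real (u j ` Xs j) (u i x) = (if j = i then 1 else 0)"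
    if "j \<in> {1..N}" for j
    using disjoint[OF that i] x by (auto simp: indicator_def)
  have select: "(\<Sum>j=1..N. indicat_real (u j ` Xs j) (u i x) *\<^sub>R g j) = g i" for g :: "nat \<Rightarrow> 'y"
  proof -
    have "(\<Sum>j=1..N. indicat_real (u j ` Xs j) (u i x) *\<^sub>R g j)
        = (\<Sum>j=1..N. if j = i then g j else 0)"
      by (rule sum.cong) (auto simp: indicator)
    also have "\<dots> = g i"
      using i by (simp add: sum.delta)
    finally show ?thesis .
  qed
  have "inv_into (Xs i) (u i) (u i x) = x"
    by (rule inv_into_f_f[OF inj_u[OF i] x])
  then show ?thesis
    unfolding fractal_operator_def using u_in_X[OF i x] by (simp only: restrict_apply' select)
qed

lemma fixed_point_iff:
  assumes "f \<in> bounded_funs d X"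
  shows "fractal_operator N X Xs u S lam f = f \<longleftrightarrow>
    (\<forall>i\<in>{1..N}. \<forall>x\<in>Xs i. f (u i x) = lam i x + S i x *\<^sub>R f x)" (is "?L \<longleftrightarrow> ?R")
proof
  assume ?L
  then show ?R
    by (metis fractal_operator_at)
next
  assume R: ?R
  show ?L
  proof (rule extensionalityI[where A = X])
    show "fractal_operator N X Xs u S lam f \<in> extensional X"
      by (simp add: fractal_operator_def)
    show "f \<in> extensional X"
      by (rule bounded_funs_extensional[OF assms])
    fix y assume "y \<in> X"
    then obtain i x where "i \<in> {1..N}" "x \<in> Xs i" "y = u i x"
      using X_cover by blast
    then show "fractal_operator N X Xs u S lam f y = f y"
      using R by (simp only: fractal_operator_at)
  qed
qed

lemma fixed_point_iff_fractal_coefficients: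
  assumes "f \<in> bounded_funs d X" and lam: "lam \<in> coefficient_families"
  shows "fractal_operator N X Xs u S lam f = f \<longleftrightarrow> fractal_coefficients N Xs u S f = lam"
proof -
  have "fractal_coefficients N Xs u S f = lam \<longleftrightarrow>
      (\<forall>i\<in>{1..N}. (\<lambda>x\<in>Xs i. f (u i x) - S i x *\<^sub>R f x) = lam i)"
    using lam unfolding fractal_coefficients_def fun_eq_iff[of "restrict _ {1..N}"]
    by (auto simp: PiE_iff extensional_def)
  also have "\<dots> \<longleftrightarrow> (\<forall>i\<in>{1..N}. \<forall>x\<in>Xs i. f (u i x) - S i x *\<^sub>R f x = lam i x)"
  proof (rule ball_cong[OF refl])
    fix i assume "i \<in> {1..N}"
    with lam have "lam i \<in> extensional (Xs i)"
      by (auto intro: bounded_funs_extensional)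
    then show "(\<lambda>x\<in>Xs i. f (u i x) - S i x *\<^sub>R f x) = lam i \<longleftrightarrow>
        (\<forall>x\<in>Xs i. f (u i x) - S i x *\<^sub>R f x = lam i x)"
      by (auto simp: fun_eq_iff extensional_def)
  qed
  finally show ?thesis
    unfolding fixed_point_iff[OF assms(1)] by (simp only: diff_eq_eq)
qed

lemma fractal_operator_bounded:
  assumes lam: "lam \<in> coefficient_families" and f: "f \<in> bounded_funs d X"
  shows "fractal_operator N X Xs u S lam f \<in> bounded_funs d X"
proof -
  have "\<exists>B. \<forall>x\<in>Xs i. d (lam i x) 0 + d (S i x *\<^sub>R f x) 0 \<le> B" if i: "i \<in> {1..N}" for i
  proof -
    obtain B where B: "\<And>x. x \<in> Xs i \<Longrightarrow> d (lam i x) 0 \<le> B"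
      using bounded_funsE[OF PiE_mem[OF lam i]] by blast
    have "restrict f (Xs i) \<in> bounded_funs d (Xs i)"
      using f Xs_subset[OF i] by (auto simp: bounded_funs_iff)
    then have "(\<lambda>x\<in>Xs i. S i x *\<^sub>R restrict f (Xs i) x) \<in> bounded_funs d (Xs i)"
      by (rule bounded_funs_multiply) (rule S_bound[OF i])
    then obtain C where C: "\<And>x. x \<in> Xs i \<Longrightarrow> d (S i x *\<^sub>R f x) 0 \<le> C"
      by (rule bounded_funsE) auto
    show ?thesis
      using B C by (intro exI[of _ "B + C"]) (auto intro: add_mono)
  qed
  then obtain B where B:
    "\<And>i x. \<lbrakk>i \<in> {1..N}; x \<in> Xs i\<rbrakk> \<Longrightarrow> d (lam i x) 0 + d (S i x *\<^sub>R f x) 0 \<le> B i"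
    by metis
  show ?thesis
  proof (rule bounded_funsI)
    fix y assume "y \<in> X"
    then obtain i x where i: "i \<in> {1..N}" and x: "x \<in> Xs i" and y: "y = u i x"
      using X_cover by blast
    have "d (lam i x + S i x *\<^sub>R f x) 0 \<le> d (lam i x) 0 + d (S i x *\<^sub>R f x) 0"
      by (rule d_add_zero_le)
    also have "\<dots> \<le> B i"
      by (rule B[OF i x])
    also have "\<dots> \<le> Max (B ` {1..N})"
      using i by simp
    finally show "d (fractal_operator N X Xs u S lam f y) 0 \<le> Max (B ` {1..N})"
      by (simp only: y fractal_operator_at[OF i x])
  qed (simp add: fractal_operator_def)
qed

lemma ex1_fixed_point:
  assumes lam: "lam \<in> coefficient_families"
  shows "\<exists>!f. f \<in> bounded_funs d X \<and> fractal_operator N X Xs u S lam f = f"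
proof (rule bounded_funs_fixed_point[OF X_nonempty s_less_1])
  fix f g y B
  assume "y \<in> X" and B: "\<And>x. x \<in> X \<Longrightarrow> d (f x) (g x) \<le> B"
  then obtain i x where i: "i \<in> {1..N}" and x: "x \<in> Xs i" and y: "y = u i x"
    using X_cover by blast
  have "d (fractal_operator N X Xs u S lam f y) (fractal_operator N X Xs u S lam g y)
      = \<bar>S i x\<bar> * d (f x) (g x)"
    unfolding y fractal_operator_at[OF i x] by (simp add: d_translate_left d_scale)
  also have "\<dots> \<le> s * B"
  proof (rule mult_mono[OF S_bound[OF i x]])
    show "d (f x) (g x) \<le> B"
      using B Xs_subset[OF i] x by blast
    show "0 \<le> s"
      using S_bound[OF i x] by linarith
  qed simp
  finally show "d (fractal_operator N X Xs u S lam f y) (fractal_operator N X Xs u S lam g y)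
      \<le> s * B" .
qed (rule fractal_operator_bounded[OF lam])

lemma local_fractal_function_fixed_point:
  assumes "lam \<in> coefficient_families"
  shows "local_fractal_function d N X Xs u S lam \<in> bounded_funs d X"
    and "fractal_operator N X Xs u S lam (local_fractal_function d N X Xs u S lam)
      = local_fractal_function d N X Xs u S lam"
  using theI'[OF ex1_fixed_point[OF assms]] by (simp_all add: local_fractal_function_def)

lemma local_fractal_function_unique:
  assumes "lam \<in> coefficient_families" and "f \<in> bounded_funs d X"
  shows "f = local_fractal_function d N X Xs u S lam \<longleftrightarrow> fractal_operator N X Xs u S lam f = f"
  using ex1_fixed_point[OF assms(1)] local_fractal_function_fixed_point[OF assms(1)] assms(2)
  by metis

lemma fractal_coefficients_closed:
  assumes f: "f \<in> bounded_funs d X"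
  shows "fractal_coefficients N Xs u S f \<in> coefficient_families"
proof -
  have "(\<lambda>x\<in>Xs i. f (u i x) - S i x *\<^sub>R f x) \<in> bounded_funs d (Xs i)" if i: "i \<in> {1..N}" for i
  proof -
    have "(\<lambda>x\<in>Xs i. f (u i x)) \<in> bounded_funs d (Xs i)"
      using f u_in_X[OF i] by (auto simp: bounded_funs_iff)
    moreover have "restrict f (Xs i) \<in> bounded_funs d (Xs i)"
      using f Xs_subset[OF i] by (auto simp: bounded_funs_iff)
    then have "(\<lambda>x\<in>Xs i. (- S i x) *\<^sub>R restrict f (Xs i) x) \<in> bounded_funs d (Xs i)"
      by (rule bounded_funs_multiply[where s = s]) (simp add: S_bound[OF i])
    ultimately have "(\<lambda>x\<in>Xs i. (\<lambda>x\<in>Xs i. f (u i x)) x +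
        (\<lambda>x\<in>Xs i. (- S i x) *\<^sub>R restrict f (Xs i) x) x) \<in> bounded_funs d (Xs i)"
      by (rule bounded_funs_add)
    also have "(\<lambda>x\<in>Xs i. (\<lambda>x\<in>Xs i. f (u i x)) x +
        (\<lambda>x\<in>Xs i. (- S i x) *\<^sub>R restrict f (Xs i) x) x) = (\<lambda>x\<in>Xs i. f (u i x) - S i x *\<^sub>R f x)"
      by (rule restrict_ext) simp
    finally show ?thesis .
  qed
  then show ?thesis
    by (simp add: fractal_coefficients_def)
qed

lemma linear_isomorphism_fractal_coefficients:
  "linear_isomorphism class_ring (bounded_fun_space d X)
    (product_module {1..N} (\<lambda>i. bounded_fun_space d (Xs i))) (fractal_coefficients N Xs u S)"
    (is "linear_isomorphism _ ?V ?W ?P")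
proof -
  have V: "vectorspace class_ring ?V"
    by (rule vectorspace_bounded_fun_space)
  have W: "vectorspace class_ring ?W"
    by (intro vectorspace_product_module class_field vectorspace_bounded_fun_space)
  have carrier: "carrier ?V = bounded_funs d X" "carrier ?W = coefficient_families"
    by (simp_all add: bounded_fun_space_def product_module_def)
  have in_X: "x \<in> X" "u i x \<in> X" if "i \<in> {1..N}" "x \<in> Xs i" for i x
    using Xs_subset u_in_X that by auto
  have "?P \<in> module_hom class_ring ?V ?W"
    unfolding module_hom_def
  proof (intro CollectI conjI allI impI)
    show "?P \<in> carrier ?V \<rightarrow> carrier ?W"
      unfolding carrier using fractal_coefficients_closed by blast
    show "?P (f \<oplus>\<^bsub>?V\<^esub> g) = ?P f \<oplus>\<^bsub>?W\<^esub> ?P g" for f g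
      using in_X
      by (auto simp: fractal_coefficients_def bounded_fun_space_def product_module_def
          scaleR_right_distrib intro!: restrict_ext)
    show "?P (c \<odot>\<^bsub>?V\<^esub> f) = c \<odot>\<^bsub>?W\<^esub> ?P f" for c f
      using in_X
      by (auto simp: fractal_coefficients_def bounded_fun_space_def product_module_def
          scaleR_right_diff_distrib intro!: restrict_ext)
  qed
  with V W have "linear_map class_ring ?V ?W ?P"
    by (auto simp: linear_map_def mod_hom_def mod_hom_axioms_def vectorspace_def)
  moreover have "bij_betw ?P (carrier ?V) (carrier ?W)"
  proof (rule bij_betw_byWitness[where f' = "local_fractal_function d N X Xs u S"])
    show "\<forall>f\<in>carrier ?V. local_fractal_function d N X Xs u S (?P f) = f"
      using local_fractal_function_unique fixed_point_iff_fractal_coefficients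
        fractal_coefficients_closed by (metis carrier(1))
    show "\<forall>lam\<in>carrier ?W. ?P (local_fractal_function d N X Xs u S lam) = lam"
      using local_fractal_function_fixed_point fixed_point_iff_fractal_coefficients
      by (metis carrier(2))
    show "?P ` carrier ?V \<subseteq> carrier ?W"
      unfolding carrier using fractal_coefficients_closed by blast
    show "local_fractal_function d N X Xs u S ` carrier ?W \<subseteq> carrier ?V"
      unfolding carrier using local_fractal_function_fixed_point(1) by blast
  qed
  ultimately show ?thesis
    by (simp add: linear_isomorphism_def)
qed

lemma linear_isomorphism_local_fractal_function:
  "linear_isomorphism class_ring (product_module {1..N} (\<lambda>i. bounded_fun_space d (Xs i)))
    (bounded_fun_space d X) (local_fractal_function d N X Xs u S)"
  using linear_isomorphism_fractal_coefficients
proof (rule linear_isomorphism_right_inverse)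
  fix lam assume "lam \<in> carrier (product_module {1..N} (\<lambda>i. bounded_fun_space d (Xs i)))"
  then have lam: "lam \<in> coefficient_families"
    by (simp add: bounded_fun_space_def product_module_def)
  show "local_fractal_function d N X Xs u S lam \<in> carrier (bounded_fun_space d X)"
    using local_fractal_function_fixed_point(1)[OF lam] by (simp add: bounded_fun_space_def)
  show "fractal_coefficients N Xs u S (local_fractal_function d N X Xs u S lam) = lam"
    using local_fractal_function_fixed_point[OF lam] fixed_point_iff_fractal_coefficients[OF _ lam]
    by blast
qed

end

text \<open>
  A real supremum bounds its family only if the family is bounded above; this is where the
  boundedness of the \<open>S\<^sub>i\<close> is used, so that their norms really control their values.
\<close>

lemma abs_le_sup_norm_on:
  assumes g: "g \<in> bounded_funs dist E" and x: "x \<in> E"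
  shows "\<bar>g x\<bar> \<le> sup_norm_on E g"
proof -
  obtain M where M: "\<forall>y\<in>E. dist (g y) (g x) < M"
    using g x unfolding bounded_funs_def by blast
  have "\<bar>g y\<bar> \<le> M + \<bar>g x\<bar>" if "y \<in> E" for y
    using M[rule_format, OF that] by (simp add: dist_real_def)
  then have "bdd_above ((\<lambda>y. \<bar>g y\<bar>) ` E)"
    by (rule bdd_aboveI2)
  then show ?thesis
    unfolding sup_norm_on_def by (rule cSUP_upper[OF x])
qed

theorem theorem3p3:
  fixes dY :: "'y::real_vector \<Rightarrow> 'y \<Rightarrow> real"
    and T :: "'x topology"
    and N :: nat
    and X :: "'x set"
    and Xs :: "nat \<Rightarrow> 'x set"
    and u :: "nat \<Rightarrow> 'x \<Rightarrow> 'x"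
    and S :: "nat \<Rightarrow> 'x \<Rightarrow> real"
  assumes "F_space dY"
    and "homogeneous_metric dY"
    and "1 < N"
    and "X \<noteq> {}" and "connectedin T X"
    and "\<And>i. i \<in> {1..N} \<Longrightarrow> Xs i \<noteq> {} \<and> connectedin T (Xs i) \<and> Xs i \<subseteq> X"
    and "\<And>i. i \<in> {1..N} \<Longrightarrow> u i \<in> Xs i \<rightarrow> X"
    and "\<And>i. i \<in> {1..N} \<Longrightarrow> bij_betw (u i) (Xs i) (u i ` Xs i)"
    and "X = (\<Union>i\<in>{1..N}. u i ` Xs i)"
    and "\<And>i j. i \<in> {1..N} \<Longrightarrow> j \<in> {1..N} \<Longrightarrow> i \<noteq> j \<Longrightarrow> u i ` Xs i \<inter> u j ` Xs j = {}"
    and "S \<in> (\<Pi>\<^sub>E i\<in>{1..N}. bounded_funs dist (Xs i))"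
    and "Max ((\<lambda>i. sup_norm_on (Xs i) (S i)) ` {1..N}) < 1"
  shows "(\<forall>lam \<in> (\<Pi>\<^sub>E i\<in>{1..N}. bounded_funs dY (Xs i)).
            local_fractal_function dY N X Xs u S lam \<in> bounded_funs dY X \<and>
            (\<forall>f \<in> bounded_funs dY X.
               (\<forall>i\<in>{1..N}. \<forall>x\<in>Xs i. f (u i x) = lam i x + S i x *\<^sub>R f x)
                 \<longleftrightarrow> f = local_fractal_function dY N X Xs u S lam)) \<and>
         linear_isomorphism class_ring
           (product_module {1..N} (\<lambda>i. bounded_fun_space dY (Xs i)))
           (bounded_fun_space dY X)
           (local_fractal_function dY N X Xs u S)"
proof -
  interpret local_fractal_system dY N X Xs u S "Max ((\<lambda>i. sup_norm_on (Xs i) (S i)) ` {1..N})"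
  proof (intro local_fractal_system.intro homogeneous_F_space.intro
      homogeneous_F_space_axioms.intro local_fractal_system_axioms.intro)
    show "\<bar>S i x\<bar> \<le> Max ((\<lambda>i. sup_norm_on (Xs i) (S i)) ` {1..N})"
      if i: "i \<in> {1..N}" and x: "x \<in> Xs i" for i x
    proof -
      have "\<bar>S i x\<bar> \<le> sup_norm_on (Xs i) (S i)"
        using assms(11) i by (intro abs_le_sup_norm_on[OF _ x]) auto
      also have "\<dots> \<le> Max ((\<lambda>i. sup_norm_on (Xs i) (S i)) ` {1..N})"
        using i by (intro Max_ge) auto
      finally show ?thesis .
    qed
    show "inj_on (u i) (Xs i)" if "i \<in> {1..N}" for i
      using assms(8)[OF that] by (rule bij_betw_imp_inj_on)
    show "Xs i \<subseteq> X" if "i \<in> {1..N}" for i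
      using assms(6)[OF that] by blast
  qed (fact assms)+
  show ?thesis
    using local_fractal_function_fixed_point(1) local_fractal_function_unique fixed_point_iff
      linear_isomorphism_local_fractal_function
    by simp
qed

end
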